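(* Let $P(X)=95X^2-84X+16$. Then \[\sum_{k=1}^\infty \frac{P(k)\,(H_{4k-1}-H_{k-1})-25k+12}{k(3k-1)(3k-2)\binom{4k}{k}}\left(\frac98\right)^{k-1}=\frac{\pi\sqrt3}{3}\log 3+\frac{15}{4}K.\]
   Context: For an integer $n\ge 0$, $H_n=\sum_{j=1}^n \frac1j$ is the $n$-th harmonic number (so $H_0=0$). The constant $K$ is \[K=L(2,\chi_{-3})=\sum_{n=0}^\infty\left(\frac{1}{(3n+1)^2}-\frac{1}{(3n+2)^2}\right).\] Here $\log$ is the natural logarithm. *)

theory Defs
  imports "HOL-Analysis.Analysis"
begin

(* The value L(2, chi_{-3}), chi_{-3} being the nonprincipal Dirichlet character modulo 3;
   consecutive terms are grouped, dropping the zero terms at multiples of 3. *)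
definition K_const :: real where
  "K_const = (\<Sum>n. 1 / (3 * real n + 1)^2 - 1 / (3 * real n + 2)^2)"

definition P :: "real \<Rightarrow> real" where
  "P x = 95 * x^2 - 84 * x + 16"

end

theory Submission
  imports Defs
begin

text \<open>Put \<open>y = 1 - x\<close>. The logarithmic beta integrals of \<open>x\<^sup>n y\<^sup>m\<close> show that the \<open>k\<close>-th term
  of the series is the integral over \<open>[0, 1]\<close> of
  \<open>- ln x * 3/4 * (3 y\<^sup>2 + 3 y + 2) * (9/8 * x y\<^sup>3)\<^sup>k\<^sup>-\<^sup>1\<close>. Since
  \<open>8 - 9 x y\<^sup>3 = (1 + 3 x\<^sup>2) (3 y\<^sup>2 + 3 y + 2)\<close>, summing the geometric series turns the left-hand
  side into six times the integral of \<open>- ln x / (1 + 3 x\<^sup>2)\<close>. Likewise \<open>K\<close> is the integral of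
  \<open>- ln x / (1 + x + x\<^sup>2)\<close>. Arctangent substitutions express both integrals by values of
  \<open>L(x) = \<integral> ln (2 sin t) dt\<close> (over \<open>[0, x]\<close>), and the duplication formula for the sine gives
  \<open>L(\<pi>/2) = 0\<close> and \<open>2 L(\<pi>/6) = 3 L(\<pi>/3)\<close>, which leaves \<open>L(\<pi>/3)\<close> as the only unknown.\<close>

section \<open>Logarithmic moments\<close>

text \<open>At 0 the value is 0, and the substitution of \<open>inverse x\<close> for
  \<open>x\<close> reduces the limit to that of \<open>ln y / y\<close> at infinity. This makes the
  antiderivatives below continuous up to the endpoint 0.\<close>

lemma continuous_on_x_ln_x: "continuous_on {0..} (\<lambda>x::real. x * ln x)"
  unfolding continuous_on_def
proof
  fix x :: real
  assume "x \<in> {0..}"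
  show "((\<lambda>x. x * ln x) \<longlongrightarrow> x * ln x) (at x within {0..})"
  proof (cases "x = 0")
    case True
    have "((\<lambda>x::real. - (ln (inverse x) / inverse x)) \<longlongrightarrow> - 0) (at_right 0)"
      by (intro tendsto_minus filterlim_compose[OF ln_x_over_x_tendsto_0 filterlim_inverse_at_top_right])
    moreover have "eventually (\<lambda>x::real. - (ln (inverse x) / inverse x) = x * ln x) (at_right 0)"
      using eventually_at_right_less[of "0::real"]
      by eventually_elim (simp add: ln_inverse divide_inverse)
    ultimately have "((\<lambda>x::real. x * ln x) \<longlongrightarrow> 0) (at_right 0)"
      by (auto elim: Lim_transform_eventually)
    then show ?thesis
      using True at_within_Ici_at_right[of "0::real"] by simp
  next
    case False
    then show ?thesis
      using \<open>x \<in> {0..}\<close> by (intro tendsto_intros) auto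
  qed
qed

lemma has_integral_power_ln:
  "((\<lambda>x::real. - ln x * x ^ m) has_integral 1 / (real m + 1)^2) {0..1}"
proof -
  \<comment> \<open>Integration by parts yields this antiderivative, up to a constant.\<close>
  define F where "F = (\<lambda>x::real. x ^ (m+1) / (real m + 1)^2 - x ^ (m+1) * ln x / (real m + 1))"
  have "((\<lambda>x::real. - ln x * x ^ m) has_integral (F 1 - F 0)) {0..1}"
  proof (rule fundamental_theorem_of_calculus_interior)
    show "continuous_on {0..1} F"
    proof -
      have "F = (\<lambda>x. x ^ (m+1) / (real m + 1)^2 - x ^ m * (x * ln x) / (real m + 1))"
        by (simp add: F_def fun_eq_iff mult_ac)
      then show ?thesis
        by (auto intro!: continuous_intros continuous_on_subset[OF continuous_on_x_ln_x])
    qed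
    fix x :: real
    assume x: "x \<in> {0<..<1}"
    have "((\<lambda>x. x ^ (m+1)) has_real_derivative (real m + 1) * x ^ m) (at x)"
      using DERIV_pow[of "m+1" x] by (simp add: add.commute)
    then have "(F has_real_derivative (real m + 1) * x ^ m / (real m + 1)^2
        - ((real m + 1) * x ^ m * ln x + inverse x * x ^ (m+1)) / (real m + 1)) (at x)"
      unfolding F_def using x by (intro DERIV_diff DERIV_cdivide DERIV_mult DERIV_ln) auto
    also have "(real m + 1) * x ^ m / (real m + 1)^2
        - ((real m + 1) * x ^ m * ln x + inverse x * x ^ (m+1)) / (real m + 1) = - ln x * x ^ m"
      using x by (simp add: power2_eq_square add_divide_distrib)
    finally show "(F has_vector_derivative - ln x * x ^ m) (at x)"
      unfolding has_real_derivative_iff_has_vector_derivative .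
  qed simp
  then show ?thesis
    by (simp add: F_def)
qed

text \<open>This is minus the derivative of the beta function in its first argument, the harmonic
  difference being a digamma difference. Splitting off one factor \<open>1 - x\<close> turns a
  moment into the difference of those for \<open>m\<close> and \<open>Suc m\<close>, so the
  induction on \<open>n\<close> needs \<open>m\<close> arbitrary.\<close>

lemma has_integral_beta_ln:
  "((\<lambda>x::real. - ln x * (x ^ m * (1 - x) ^ n)) has_integral
     fact m * fact n / fact (m + n + 1) * (harm (m + n + 1) - harm m)) {0..1}"
proof (induction n arbitrary: m)
  case 0
  have "fact m * fact 0 / fact (m + 0 + 1) * (harm (m + 0 + 1) - harm m) = 1 / (real m + 1)^2"
    by (simp add: harm_Suc divide_simps power2_eq_square add.commute)
  then show ?case
    using has_integral_power_ln[of m] by (simp only: power_0 mult_1_right)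
next
  case (Suc n)
  define d where "d = (harm (m + n + 1) - harm m :: real)"
  define s where "s = real m + real n + 2"
  have s: "s > 0" "s \<noteq> real m + 1"
    by (auto simp: s_def)
  have h: "(harm (Suc m + n + 1) - harm (Suc m) :: real) = d + 1 / s - 1 / (real m + 1)"
          "(harm (m + Suc n + 1) - harm m :: real) = d + 1 / s"
    using harm_Suc[of "m + n + 1", where ?'a = real] harm_Suc[of m, where ?'a = real]
    by (simp_all add: d_def s_def inverse_eq_divide add_ac)
  have f: "fact (Suc m + n + 1) = s * fact (m + n + 1)" "fact (m + Suc n + 1) = s * fact (m + n + 1)"
    by (simp_all add: s_def algebra_simps)
  have "((\<lambda>x::real. - ln x * (x ^ m * (1 - x) ^ n) - - ln x * (x ^ Suc m * (1 - x) ^ n)) has_integral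
     fact m * fact n / fact (m + n + 1) * (harm (m + n + 1) - harm m)
     - fact (Suc m) * fact n / fact (Suc m + n + 1) * (harm (Suc m + n + 1) - harm (Suc m))) {0..1}"
    by (intro has_integral_diff Suc.IH)
  also have "(\<lambda>x::real. - ln x * (x ^ m * (1 - x) ^ n) - - ln x * (x ^ Suc m * (1 - x) ^ n))
      = (\<lambda>x. - ln x * (x ^ m * (1 - x) ^ Suc n))"
    by (simp add: fun_eq_iff algebra_simps)
  also have "fact m * fact n / fact (m + n + 1) * (harm (m + n + 1) - harm m)
     - fact (Suc m) * fact n / fact (Suc m + n + 1) * (harm (Suc m + n + 1) - harm (Suc m))
     = fact m * fact n / (s * fact (m + n + 1)) *
         (s * d - (real m + 1) * (d + 1 / s - 1 / (real m + 1)))"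
  proof -
    have "c / w * d - a * c / (s * w) * e = c / (s * w) * (s * d - a * e)" if "w > 0" for a c e w :: real
      using s that by (simp add: field_simps)
    from this[of "fact (m + n + 1)" "fact m * fact n" "real m + 1"] show ?thesis
      unfolding h f d_def[symmetric] fact_Suc by (simp add: mult.assoc add.commute)
  qed
  \<comment> \<open>Both \<open>s - (m + 1)\<close> and the numerator of
    \<open>1 - (m + 1) / s\<close> equal \<open>n + 1\<close>.\<close>
  also have "s * d - (real m + 1) * (d + 1 / s - 1 / (real m + 1)) = (real n + 1) * (d + 1 / s)"
    using s by (simp add: divide_simps) (simp add: s_def algebra_simps)
  also have "fact m * fact n / (s * fact (m + n + 1)) * ((real n + 1) * (d + 1 / s))
     = fact m * fact (Suc n) / fact (m + Suc n + 1) * (harm (m + Suc n + 1) - harm m)"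
    unfolding h f by (simp add: add_ac)
  finally show ?case .
qed

section \<open>The log-sine integral\<close>

text \<open>The singular part of \<open>ln (2 sin t) = ln t + ln (2 sin t / t)\<close> is integrated explicitly,
  so that \<open>log_sine x\<close> is the integral of \<open>ln (2 sin t)\<close> over \<open>[0, x]\<close>.\<close>

definition ln_sinc :: "real \<Rightarrow> real" where
  "ln_sinc t = (if t = 0 then ln 2 else ln (2 * (sin t / t)))"

definition log_sine :: "real \<Rightarrow> real" where
  "log_sine x = x * ln x - x + integral {0..x} ln_sinc"

text \<open>The singularity at 0 is removable because \<open>sin t / t\<close> tends to 1. The
  endpoint 2 is a convenient number between \<open>pi / 2\<close>, the largest argument needed, and
  \<open>pi\<close>, where the sine vanishes.\<close>

lemma continuous_on_ln_sinc: "continuous_on {0..2} ln_sinc"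
  unfolding continuous_on_def
proof
  fix x :: real
  assume x: "x \<in> {0..2}"
  have "(ln_sinc \<longlongrightarrow> ln_sinc x) (at x)"
  proof (cases "x = 0")
    case True
    have "((\<lambda>t::real. sin t / t) \<longlongrightarrow> 1) (at 0)"
      using DERIV_sin[of "0::real"] by (simp add: DERIV_def)
    then have "((\<lambda>t::real. ln (2 * (sin t / t))) \<longlongrightarrow> ln (2 * 1)) (at 0)"
      by (intro tendsto_intros) auto
    then have "((\<lambda>t::real. ln (2 * (sin t / t))) \<longlongrightarrow> ln 2) (at 0)"
      by simp
    moreover have "eventually (\<lambda>t. ln (2 * (sin t / t)) = ln_sinc t) (at 0)"
      by (auto simp: eventually_at_filter ln_sinc_def)
    ultimately show ?thesis
      using True by (auto simp: ln_sinc_def elim: Lim_transform_eventually)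
  next
    case False
    then have "sin x > 0"
      using x pi_half_less_two pi_gt3 by (intro sin_gt_zero) auto
    then have "((\<lambda>t. ln (2 * (sin t / t))) \<longlongrightarrow> ln (2 * (sin x / x))) (at x)"
      using False x by (intro tendsto_intros) auto
    moreover have "eventually (\<lambda>t. ln (2 * (sin t / t)) = ln_sinc t) (at x)"
      using False by (auto simp: ln_sinc_def eventually_at_filter intro!: eventually_mono[OF t1_space_nhds])
    ultimately show ?thesis
      using False by (auto simp: ln_sinc_def elim: Lim_transform_eventually)
  qed
  then show "(ln_sinc \<longlongrightarrow> ln_sinc x) (at x within {0..2})"
    by (rule tendsto_within_subset) auto
qed

lemma log_sine_0 [simp]: "log_sine 0 = 0"
  by (simp add: log_sine_def)

lemma continuous_on_log_sine: "continuous_on {0..2} log_sine"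
  unfolding log_sine_def
  by (intro continuous_intros continuous_on_subset[OF continuous_on_x_ln_x]
        indefinite_integral_continuous_1 integrable_continuous_interval continuous_on_ln_sinc) auto

text \<open>The derivative \<open>ln x\<close> of \<open>x * ln x - x\<close> cancels the
  \<open>- ln x\<close> contained in \<open>ln_sinc x\<close>.\<close>

lemma log_sine_deriv:
  assumes "0 < x" "x < 2"
  shows "(log_sine has_real_derivative ln (2 * sin x)) (at x)"
proof -
  have "((\<lambda>x. integral {0..x} ln_sinc) has_real_derivative ln_sinc x) (at x within {0..2})"
    using assms by (intro integral_has_real_derivative continuous_on_ln_sinc) auto
  then have *: "((\<lambda>x. integral {0..x} ln_sinc) has_real_derivative ln_sinc x) (at x)"
    using assms by (simp add: at_within_Icc_at)
  have "sin x > 0"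
    using assms pi_gt3 by (intro sin_gt_zero) auto
  then have "ln (2 * (sin x / x)) = ln (2 * sin x) - ln x"
    using assms ln_div[of "2 * sin x" x] by simp
  then have "ln (2 * sin x) = 1 * ln x + inverse x * x - 1 + ln_sinc x"
    using assms by (simp add: ln_sinc_def)
  then show ?thesis
    unfolding log_sine_def using assms
    by (auto intro!: derivative_eq_intros *)
qed

lemma log_sine_chain:
  assumes "(g has_real_derivative g') (at x)" "0 < g x" "g x < 2"
  shows "((\<lambda>x. log_sine (g x)) has_real_derivative ln (2 * sin (g x)) * g') (at x)"
  using DERIV_chain2[OF log_sine_deriv assms(1)] assms by simp

text \<open>By \<open>sin (2 * t) = 2 * sin t * cos t\<close>, the function \<open>f\<close> below
  has derivative 0, so it keeps its value \<open>2 * log_sine (pi / 2)\<close> at 0. The bound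
  \<open>pi / 4\<close> keeps \<open>2 * x\<close> within the first quadrant.\<close>

lemma log_sine_double:
  assumes "0 \<le> x" "x \<le> pi / 4"
  shows "log_sine (2 * x) = 2 * log_sine x - 2 * log_sine (pi / 2 - x) + 2 * log_sine (pi / 2)"
proof -
  define f where "f = (\<lambda>x. log_sine (2 * x) - 2 * log_sine x + 2 * log_sine (pi / 2 - x))"
  have "f x = f 0"
  proof (cases "x = 0")
    case False
    then have "x > 0" using assms by simp
    then show ?thesis
    proof (rule DERIV_isconst2[of 0 x f x])
      show "continuous_on {0..x} f"
        unfolding f_def using assms pi_half_less_two
        by (intro continuous_intros continuous_on_compose2[OF continuous_on_log_sine]) auto
      fix t
      assume t: "0 < t" "t < x"
      have "sin t > 0" "cos t > 0"
        using t assms pi_gt3 by (auto intro!: sin_gt_zero cos_gt_zero)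
      then have "ln (2 * sin t) + ln (2 * cos t) = ln ((2 * sin t) * (2 * cos t))"
        by (intro ln_mult_pos[symmetric]) auto
      also have "(2 * sin t) * (2 * cos t) = 2 * sin (2 * t)"
        by (simp add: sin_double)
      finally have "ln (2 * sin (2 * t)) = ln (2 * sin t) + ln (2 * sin (pi / 2 - t))"
        by (simp add: cos_sin_eq)
      then show "DERIV f t :> 0"
        unfolding f_def using t assms pi_half_less_two
        by (auto intro!: derivative_eq_intros log_sine_chain)
    qed (use \<open>x > 0\<close> in auto)
  qed auto
  then show ?thesis
    by (simp add: f_def)
qed

text \<open>At \<open>x = pi / 4\<close> the two middle terms of the duplication formula
  cancel.\<close>

lemma log_sine_pi_half: "log_sine (pi / 2) = 0"
  using log_sine_double[of "pi / 4"] by simp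

lemma log_sine_pi_sixth: "log_sine (pi / 6) = 3 / 2 * log_sine (pi / 3)"
  using log_sine_double[of "pi / 6"] by (simp add: log_sine_pi_half)

section \<open>The two logarithmic integrals as log-sine values\<close>

lemma ln_tan:
  fixes t :: real
  assumes "sin t > 0" "cos t > 0"
  shows "ln (tan t) = ln (2 * sin t) - ln (2 * cos t)"
  using assms ln_div[of "2 * sin t" "2 * cos t"] by (simp add: tan_def)

text \<open>Substitute \<open>tan t = sqrt 3 * x\<close>, so that \<open>t\<close> runs from 0 to
  \<open>pi / 3\<close> and \<open>ln x\<close> is
  \<open>ln (2 * sin t) - ln (2 * cos t) - ln 3 / 2\<close>. The cosine part is integrated by
  \<open>log_sine (pi / 2 - t)\<close>, whose inner derivative supplies the minus sign.\<close>

lemma has_integral_ln_1_3x2: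
  "((\<lambda>x::real. - ln x / (1 + 3 * x^2)) has_integral
     (pi / 6 * ln 3 - 5 / 2 * log_sine (pi / 3)) / sqrt 3) {0..1}"
proof -
  define F where "F = (\<lambda>x. - (log_sine (arctan (sqrt 3 * x)) + log_sine (pi / 2 - arctan (sqrt 3 * x))
      - ln 3 / 2 * arctan (sqrt 3 * x)) / sqrt 3)"
  have ran: "arctan (sqrt 3 * x) \<in> {0..2} \<and> pi / 2 - arctan (sqrt 3 * x) \<in> {0..2}" if "x \<ge> 0" for x
  proof -
    have "arctan (sqrt 3 * x) \<ge> 0"
      using that by simp
    then show ?thesis
      using arctan_ubound[of "sqrt 3 * x"] pi_half_less_two unfolding atLeastAtMost_iff by linarith
  qed
  have "((\<lambda>x::real. - ln x / (1 + 3 * x^2)) has_integral (F 1 - F 0)) {0..1}"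
  proof (rule fundamental_theorem_of_calculus_interior)
    show "continuous_on {0..1} F"
      unfolding F_def using ran
      by (intro continuous_intros continuous_on_compose2[OF continuous_on_log_sine]) auto
    fix x :: real
    assume x: "x \<in> {0<..<1}"
    define t where "t = arctan (sqrt 3 * x)"
    have t: "0 < t" "t < pi / 2" "tan t = sqrt 3 * x"
      using x arctan_ubound by (auto simp: t_def tan_arctan)
    then have "sin t > 0" "cos t > 0"
      using pi_gt3 by (auto intro!: sin_gt_zero cos_gt_zero)
    from ln_tan[OF this] have ln: "ln x = ln (2 * sin t) - ln (2 * cos t) - ln 3 / 2"
      using x t by (simp add: ln_mult ln_sqrt)
    have pos': "1 + 3 * x^2 > 0"
      by (intro add_pos_nonneg) auto
    have d: "((\<lambda>x. arctan (sqrt 3 * x)) has_real_derivative sqrt 3 / (1 + 3 * x^2)) (at x)"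
      by (auto intro!: derivative_eq_intros simp: power_mult_distrib divide_inverse mult_ac)
    have d': "((\<lambda>x. pi / 2 - arctan (sqrt 3 * x)) has_real_derivative - (sqrt 3 / (1 + 3 * x^2))) (at x)"
      using DERIV_diff[OF DERIV_const d, of "pi / 2"] by simp
    have "(F has_real_derivative
       - (ln (2 * sin t) * (sqrt 3 / (1 + 3 * x^2))
          + ln (2 * sin (pi / 2 - t)) * (- (sqrt 3 / (1 + 3 * x^2)))
          - ln 3 / 2 * (sqrt 3 / (1 + 3 * x^2))) / sqrt 3) (at x)"
      unfolding F_def t_def using t pi_half_less_two
      by (intro DERIV_cdivide DERIV_minus DERIV_diff[of _ _ _ _ "\<lambda>x. ln 3 / 2 * _ x"] DERIV_add DERIV_cmult d d' log_sine_chain)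
         (auto simp flip: t_def)
    moreover have "- (a * (sqrt 3 / w) + b * (- (sqrt 3 / w)) - ln 3 / 2 * (sqrt 3 / w)) / sqrt 3
        = - (a - b - ln 3 / 2) / w" if "w > 0" for a b w :: real
      using that by (simp add: field_simps)
    note this[OF pos']
    ultimately show "(F has_vector_derivative - ln x / (1 + 3 * x^2)) (at x)"
      unfolding has_real_derivative_iff_has_vector_derivative [symmetric] ln by (simp add: cos_sin_eq)
  qed simp
  also have "F 1 - F 0 = (pi / 6 * ln 3 - 5 / 2 * log_sine (pi / 3)) / sqrt 3"
  proof -
    have a: "arctan (sqrt 3) = pi / 3"
      using arctan_tan[of "pi / 3"] pi_gt3 by (simp add: tan_60)
    \<comment> \<open>At \<open>x = 1\<close> the log-sine values at \<open>pi / 3\<close> and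
      \<open>pi / 6\<close> add up to 5/2 times the former.\<close>
    have "pi / 2 - pi / 3 = pi / 6" by simp
    then have "F 1 = - (5 / 2 * log_sine (pi / 3) - pi / 6 * ln 3) / sqrt 3"
      unfolding F_def mult_1_right a by (simp add: log_sine_pi_sixth)
    moreover have "F 0 = 0"
      by (simp add: F_def log_sine_pi_half)
    ultimately show ?thesis
      by simp
  qed
  finally show ?thesis .
qed

text \<open>Completing the square suggests \<open>tan t = (2 * x + 1) / sqrt 3\<close>, with
  \<open>t\<close> from \<open>pi / 6\<close> to \<open>pi / 3\<close>. Then
  \<open>x = sin (t - pi / 6) / cos t\<close>, so \<open>ln x\<close> is again a difference of two
  log-sine integrands.\<close>

lemma has_integral_ln_1_x_x2:
  "((\<lambda>x::real. - ln x / (1 + x + x^2)) has_integral - 4 / sqrt 3 * log_sine (pi / 3)) {0..1}"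
proof -
  define g where "g = (\<lambda>x. arctan ((2 * x + 1) / sqrt 3))"
  define F where "F = (\<lambda>x. - 2 / sqrt 3 * (log_sine (g x - pi / 6) + log_sine (pi / 2 - g x)))"
  have a6: "arctan (1 / sqrt 3) = pi / 6"
    using arctan_tan[of "pi / 6"] pi_gt3 by (simp add: tan_30)
  have a3: "arctan (3 / sqrt 3) = pi / 3"
    using arctan_tan[of "pi / 3"] pi_gt3 by (simp add: tan_60 real_div_sqrt)
  have lo: "pi / 6 \<le> g x" if "x \<ge> 0" for x
    unfolding g_def a6[symmetric] using that by (intro arctan_monotone') (auto simp: divide_right_mono)
  have lo': "pi / 6 < g x" if "x > 0" for x
    unfolding g_def a6[symmetric] using that by (intro arctan_monotone) (auto simp: divide_strict_right_mono)
  have hi: "g x < pi / 2" for x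
    unfolding g_def by (rule arctan_ubound)
  have "((\<lambda>x::real. - ln x / (1 + x + x^2)) has_integral (F 1 - F 0)) {0..1}"
  proof (rule fundamental_theorem_of_calculus_interior)
    have "continuous_on {0..1} g"
      unfolding g_def by (intro continuous_intros) auto
    moreover have "g x - pi / 6 \<in> {0..2} \<and> pi / 2 - g x \<in> {0..2}" if "x \<ge> 0" for x
      using lo[OF that] hi[of x] pi_half_less_two pi_gt_zero by auto
    ultimately show "continuous_on {0..1} F"
      unfolding F_def 
      by (intro continuous_intros continuous_on_compose2[OF continuous_on_log_sine]) auto
    fix x :: real
    assume x: "x \<in> {0<..<1}"
    define t where "t = g x"
    have t: "pi / 6 < t" "t < pi / 2" "tan t = (2 * x + 1) / sqrt 3"
      using x lo' hi by (auto simp: t_def g_def tan_arctan)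
    then have pos: "sin (t - pi / 6) > 0" "cos t > 0"
      using pi_gt3 by (auto intro!: sin_gt_zero cos_gt_zero)
    have "sin t = (2 * x + 1) / sqrt 3 * cos t"
      using t pos by (simp add: tan_def field_simps)
    moreover have "sin (t - pi / 6) = sin t * (sqrt 3 / 2) - cos t / 2"
      by (simp add: sin_diff cos_30 sin_30)
    ultimately have "sin (t - pi / 6) = x * cos t"
      by (simp add: field_simps)
    then have "x = (2 * sin (t - pi / 6)) / (2 * cos t)"
      using pos by simp
    then have ln: "ln x = ln (2 * sin (t - pi / 6)) - ln (2 * cos t)"
      using ln_div[of "2 * sin (t - pi / 6)" "2 * cos t"] pos by simp
    have pos': "1 + x + x^2 > 0"
      using x by (auto intro!: add_pos_pos)
    have "1 + ((2 * x + 1) / sqrt 3)^2 = 4 / 3 * (1 + x + x^2)"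
      by (simp add: power_divide field_simps power2_eq_square)
    then have d: "(g has_real_derivative sqrt 3 / (2 * (1 + x + x^2))) (at x)"
      unfolding g_def using pos' 
      by (auto intro!: derivative_eq_intros simp: divide_simps)
    have "(F has_real_derivative
       - 2 / sqrt 3 * (ln (2 * sin (t - pi / 6)) * (sqrt 3 / (2 * (1 + x + x^2)))
          + ln (2 * sin (pi / 2 - t)) * (- (sqrt 3 / (2 * (1 + x + x^2)))))) (at x)"
      unfolding F_def t_def using t pi_half_less_two pi_gt_zero
      by (intro DERIV_cmult DERIV_add log_sine_chain)
         (auto simp flip: t_def intro!: derivative_eq_intros d)
    moreover have "- 2 / sqrt 3 * (a * (sqrt 3 / (2 * w)) + b * (- (sqrt 3 / (2 * w)))) = - (a - b) / w"
      if "w > 0" for a b w :: real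
      using that by (simp add: field_simps)
    note this[OF pos']
    ultimately show "(F has_vector_derivative - ln x / (1 + x + x^2)) (at x)"
      unfolding has_real_derivative_iff_has_vector_derivative [symmetric] ln by (simp add: cos_sin_eq)
  qed simp
  also have "F 1 - F 0 = - 4 / sqrt 3 * log_sine (pi / 3)"
  proof -
    \<comment> \<open>The sum of log-sine values in \<open>F\<close> is
      \<open>2 * log_sine (pi / 6) = 3 * log_sine (pi / 3)\<close> at 1 and
      \<open>log_sine (pi / 3)\<close> at 0.\<close>
    have g: "g 0 = pi / 6" "g 1 = pi / 3"
      using a6 a3 by (simp_all add: g_def)
    have "pi / 2 - pi / 3 = pi / 6" "pi / 3 - pi / 6 = pi / 6" "pi / 2 - pi / 6 = pi / 3" by simp_all
    then show ?thesis
      unfolding F_def g by (simp add: log_sine_pi_sixth)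
  qed
  finally show ?thesis .
qed

section \<open>Summation under the integral\<close>

text \<open>Expand \<open>1 / (1 + x + x^2) = (1 - x) / (1 - x^3)\<close> in powers of
  \<open>x^3\<close> and integrate termwise. Only finite sums are used, since the geometric series
  diverges at \<open>x = 1\<close>; the integrated remainder is at most the logarithmic moment of
  \<open>x ^ (3*N)\<close>.\<close>

lemma K_const_log_sine: "K_const = - 4 / sqrt 3 * log_sine (pi / 3)"
proof -
  define c where "c = - 4 / sqrt 3 * log_sine (pi / 3)"
  define a where "a = (\<lambda>n. 1 / (3 * real n + 1)^2 - 1 / (3 * real n + 2)^2)"
  have trm: "((\<lambda>x::real. - ln x * x ^ (3*n) - - ln x * x ^ (3*n+1)) has_integral a n) {0..1}" for n
    using has_integral_diff[OF has_integral_power_ln[of "3*n"] has_integral_power_ln[of "3*n+1"]]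
    by (simp add: a_def add_ac)
  have part: "((\<lambda>x::real. \<Sum>n<N. - ln x * x ^ (3*n) - - ln x * x ^ (3*n+1)) has_integral (\<Sum>n<N. a n)) {0..1}" for N
    by (intro has_integral_sum trm) auto
  have bound: "\<bar>c - (\<Sum>n<N. a n)\<bar> \<le> 1 / (3 * real N + 1)^2" for N
  proof -
    have eq: "- ln x / (1 + x + x^2) - (\<Sum>n<N. - ln x * x ^ (3*n) - - ln x * x ^ (3*n+1))
        = - ln x * x ^ (3*N) / (1 + x + x^2)" if "x \<in> {0..1}" for x :: real
    proof -
      have pos: "1 + x + x^2 > 0"
        using that by (auto intro!: add_pos_nonneg)
      have "(\<Sum>n<N. - ln x * x ^ (3*n) - - ln x * x ^ (3*n+1)) = - ln x * ((1 - x) * (\<Sum>n<N. (x^3) ^ n))"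
        unfolding sum_distrib_left power_add power_mult power_one_right
        by (intro sum.cong refl) (simp add: algebra_simps)
      moreover from pos have "(1 + x + x^2) * ((1 - x) * (\<Sum>n<N. (x^3) ^ n)) = 1 - (x^3)^N"
        using one_diff_power_eq[of "x^3" N]
        by (simp add: algebra_simps power2_eq_square power3_eq_cube)
      then have "(1 - x) * (\<Sum>n<N. (x^3) ^ n) = (1 - (x^3)^N) / (1 + x + x^2)"
        using pos by (simp add: eq_divide_eq mult.commute)
      moreover have "- ln x / w - - ln x * ((1 - Q) / w) = - ln x * Q / w" for w Q
        by (simp add: diff_divide_distrib right_diff_distrib)
      ultimately show ?thesis
        by (simp only: power_mult)
    qed
    have int: "((\<lambda>x::real. - ln x * x ^ (3*N) / (1 + x + x^2)) has_integral c - (\<Sum>n<N. a n)) {0..1}"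
      using has_integral_diff[OF has_integral_ln_1_x_x2 part[of N]] eq
      unfolding c_def by (rule has_integral_eq[rotated]) auto
    have nn: "- ln x * x ^ (3*N) \<ge> 0" if "x \<in> {0..1}" for x :: real
      using that by (cases "x = 0") (auto simp: mult_nonpos_nonneg)
    have "c - (\<Sum>n<N. a n) \<ge> 0"
    proof (rule has_integral_nonneg[OF int])
      fix x :: real
      assume x: "x \<in> {0..1}"
      then show "0 \<le> - ln x * x ^ (3*N) / (1 + x + x^2)"
        by (intro divide_nonneg_nonneg nn) auto
    qed
    moreover have "c - (\<Sum>n<N. a n) \<le> 1 / (real (3*N) + 1)^2"
    proof (rule has_integral_le[OF int has_integral_power_ln])
      fix x :: real
      assume x: "x \<in> {0..1}"
      then have "1 + x + x^2 \<ge> 1" by simp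
      then show "- ln x * x ^ (3*N) / (1 + x + x^2) \<le> - ln x * x ^ (3*N)"
        using divide_left_mono[of 1 "1 + x + x^2" "- ln x * x ^ (3*N)"] nn[OF x] by simp
    qed
    ultimately show ?thesis by simp
  qed
  have "a sums c"
    unfolding sums_def
  proof (rule LIM_zero_cancel, rule Lim_null_comparison)
    have "1 / (3 * real N + 1)^2 \<le> inverse (real (Suc N))" for N
    proof -
      have "real (Suc N) \<le> (3 * real N + 1)^2"
        by (simp add: power2_eq_square algebra_simps)
      then show ?thesis
        by (simp add: le_imp_inverse_le flip: inverse_eq_divide)
    qed
    with bound have "norm ((\<Sum>n<N. a n) - c) \<le> inverse (real (Suc N))" for N
      by (metis abs_minus_commute order_trans real_norm_def)
    then show "eventually (\<lambda>N. norm ((\<Sum>n<N. a n) - c) \<le> inverse (real (Suc N))) sequentially"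
      by simp
  qed (rule LIMSEQ_inverse_real_of_nat)
  then show ?thesis
    unfolding K_const_def a_def c_def by (rule sums_unique[symmetric])
qed

section \<open>The series and its integral\<close>

lemma series_term_has_integral:
  fixes n :: nat
  defines "k \<equiv> Suc n"
  shows "((\<lambda>x::real. 3 / 4 * (- ln x * (3 * (1-x)^2 + 3 * (1-x) + 2)) * (9 / 8 * (x * (1-x)^3)) ^ n)
    has_integral (P (real k) * (harm (4 * k - 1) - harm (k - 1)) - 25 * real k + 12)
              / (real k * (3 * real k - 1) * (3 * real k - 2) * real ((4 * k) choose k))
              * (9 / 8) ^ (k - 1)) {0..1}"
proof -
  define r where "r = real n"
  define D where "D = (harm (4*n+1) - harm n :: real)"
  \<comment> \<open>\<open>f j\<close> is the logarithmic moment of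
    \<open>x ^ n * (1 - x) ^ (3*n + j)\<close>. The three moments are reduced to the common factor
    \<open>A\<close> and the common harmonic difference \<open>D\<close>.\<close>
  define f where "f = (\<lambda>j. fact n * fact (3*n+j) / fact (n + (3*n+j) + 1) * (harm (n + (3*n+j) + 1) - harm n) :: real)"
  have r: "r \<ge> 0" by (simp add: r_def)
  have H: "harm (4*n+2) - harm n = D + 1 / (4*r+2)" "harm (4*n+3) - harm n = D + 1 / (4*r+2) + 1 / (4*r+3)"
    using harm_Suc[of "4*n+1", where ?'a = real] harm_Suc[of "4*n+2", where ?'a = real]
    by (simp_all add: D_def r_def inverse_eq_divide eval_nat_numeral add_ac)
  define A where "A = (fact n * fact (3*n) / fact (4*n+1) :: real)"
  have f4: "fact (4*n+2) = (4*r+2) * fact (4*n+1)" "fact (4*n+3) = (4*r+3) * (4*r+2) * fact (4*n+1)"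
     "fact (4*n+4) = (4*r+4) * (4*r+3) * (4*r+2) * fact (4*n+1)"
    by (simp_all add: r_def eval_nat_numeral algebra_simps)
  have f3: "fact (3*n+1) = (3*r+1) * fact (3*n)" "fact (3*n+2) = (3*r+2) * (3*r+1) * fact (3*n)"
     "fact (3*n+3) = (3*r+3) * (3*r+2) * (3*r+1) * fact (3*n)"
    by (simp_all add: r_def eval_nat_numeral algebra_simps)
  have e: "f 0 = A * D"
    "f 1 = A * (3*r+1) / (4*r+2) * (D + 1 / (4*r+2))"
    "f 2 = A * (3*r+2) * (3*r+1) / ((4*r+3) * (4*r+2)) * (D + 1 / (4*r+2) + 1 / (4*r+3))"
  proof -
    have *: "n + (3*n+0) + 1 = 4*n+1" "n + (3*n+1) + 1 = 4*n+2" "n + (3*n+2) + 1 = 4*n+3" "3*n+0 = 3*n"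
      by simp_all
    show "f 0 = A * D"
      "f 1 = A * (3*r+1) / (4*r+2) * (D + 1 / (4*r+2))"
      "f 2 = A * (3*r+2) * (3*r+1) / ((4*r+3) * (4*r+2)) * (D + 1 / (4*r+2) + 1 / (4*r+3))"
      unfolding f_def * H f3 f4 A_def D_def[symmetric]
      by (simp_all add: D_def mult_ac del: fact_Suc)
  qed
  have bin: "real ((4 * k) choose k) =
      (4*r+4) * (4*r+3) * (4*r+2) / (A * ((r+1) * ((3*r+3) * (3*r+2) * (3*r+1))))"
  proof -
    have "real ((4 * k) choose k) = fact (4*n+4) / (fact (Suc n) * fact (3*n+3))"
      by (subst binomial_fact) (auto simp: k_def algebra_simps)
    also have "\<dots> = (4*r+4) * (4*r+3) * (4*r+2) / (A * ((r+1) * ((3*r+3) * (3*r+2) * (3*r+1))))"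
      unfolding f4 f3 fact_Suc A_def by (simp add: r_def add_ac)
    finally show ?thesis .
  qed
  have "A > 0"
    by (simp add: A_def)
  have eq: "3 / 4 * (9 / 8) ^ n * (3 * f 2 + 3 * f 1 + 2 * f 0)
      = (P (real k) * (harm (4 * k - 1) - harm (k - 1)) - 25 * real k + 12)
              / (real k * (3 * real k - 1) * (3 * real k - 2) * real ((4 * k) choose k))
              * (9 / 8) ^ (k - 1)"
  proof -
    define u v where "u = 4*r+2" and "v = 4*r+3"
    have uv: "u > 0" "v > 0"
      using r by (auto simp: u_def v_def)
    have k: "real k = r + 1" "k - 1 = n" "4 * k - 1 = 4 * n + 3"
      by (auto simp: k_def r_def)
    \<comment> \<open>Over the denominator \<open>u * v\<close>, the coefficient of
      \<open>D + 1/u + 1/v\<close>, the harmonic difference of the series, is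
      \<open>P (r+1)\<close>. The moments \<open>f 0\<close> and \<open>f 1\<close> contain shorter
      harmonic differences, and the missing reciprocals produce the linear term.\<close>
    have "3 * f 2 + 3 * f 1 + 2 * f 0 = A * (P (r+1) * (D + 1/u + 1/v) - 25 * (r+1) + 12) / (u * v)"
      unfolding e P_def u_def[symmetric] v_def[symmetric] using uv
      by (simp add: divide_simps) (simp add: u_def v_def algebra_simps power2_eq_square)
    \<comment> \<open>The linear factors \<open>k\<close>, \<open>3*k - 1\<close>,
      \<open>3*k - 2\<close> cancel against the binomial coefficient. The surviving
      \<open>(4*r+4) / (3*r+3) = 4/3\<close> accounts for the 3/4 in the integrand.\<close>
    moreover have "(r+1) * (3*(r+1) - 1) * (3*(r+1) - 2) * real ((4 * k) choose k) = 4/3 * (u * v / A)"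
      unfolding bin u_def[symmetric] v_def[symmetric] using r \<open>A > 0\<close>
      by (simp add: divide_simps) (simp add: algebra_simps)
    ultimately show ?thesis
      unfolding k H u_def[symmetric] v_def[symmetric] using uv \<open>A > 0\<close> by simp
  qed
  have "((\<lambda>x::real. 3 / 4 * (9 / 8) ^ n * (3 * (- ln x * (x ^ n * (1 - x) ^ (3*n+2)))
       + 3 * (- ln x * (x ^ n * (1 - x) ^ (3*n+1))) + 2 * (- ln x * (x ^ n * (1 - x) ^ (3*n+0)))))
     has_integral 3 / 4 * (9 / 8) ^ n * (3 * f 2 + 3 * f 1 + 2 * f 0)) {0..1}"
    unfolding f_def by (intro has_integral_mult_right has_integral_add has_integral_beta_ln)
  also have "(\<lambda>x::real. 3 / 4 * (9 / 8) ^ n * (3 * (- ln x * (x ^ n * (1 - x) ^ (3*n+2)))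
       + 3 * (- ln x * (x ^ n * (1 - x) ^ (3*n+1))) + 2 * (- ln x * (x ^ n * (1 - x) ^ (3*n+0)))))
     = (\<lambda>x. 3 / 4 * (- ln x * (3 * (1-x)^2 + 3 * (1-x) + 2)) * (9 / 8 * (x * (1-x)^3)) ^ n)"
    unfolding power_add power_mult power_mult_distrib by (simp add: fun_eq_iff algebra_simps)
  finally show ?thesis
    unfolding eq .
qed

theorem theorem2:
  shows "(\<lambda>n. let k = Suc n in
            (P (real k) * (harm (4 * k - 1) - harm (k - 1)) - 25 * real k + 12)
              / (real k * (3 * real k - 1) * (3 * real k - 2) * real ((4 * k) choose k))
              * (9 / 8) ^ (k - 1))
         sums (pi * sqrt 3 / 3 * ln 3 + 15 / 4 * K_const)"
proof -
  define a :: "nat \<Rightarrow> real" where "a = (\<lambda>n. let k = Suc n in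
            (P (real k) * (harm (4 * k - 1) - harm (k - 1)) - 25 * real k + 12)
              / (real k * (3 * real k - 1) * (3 * real k - 2) * real ((4 * k) choose k))
              * (9 / 8) ^ (k - 1))"
  define c where "c = 6 * ((pi / 6 * ln 3 - 5 / 2 * log_sine (pi / 3)) / sqrt 3)"
  define q where "q = (\<lambda>x::real. 9 / 8 * (x * (1-x)^3))"
  define t where "t = (\<lambda>n x. 3 / 4 * (- ln x * (3 * (1-x)^2 + 3 * (1-x) + 2)) * q x ^ n)"
  have trm: "(t n has_integral a n) {0..1}" for n
    using series_term_has_integral[of n] unfolding t_def q_def a_def Let_def .
  have int6: "((\<lambda>x::real. 6 * (- ln x / (1 + 3 * x^2))) has_integral c) {0..1}"
    unfolding c_def by (intro has_integral_mult_right has_integral_ln_1_3x2)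
  \<comment> \<open>The crude estimate gives 9/32; any bound below 1 makes the remainder decay
    geometrically, uniformly in \<open>x\<close>.\<close>
  have q: "0 \<le> q x \<and> q x \<le> 1 / 2" if "x \<in> {0..1}" for x
  proof -
    have "(1 - x)^3 \<le> 1 - x"
      using that power_decreasing[of 1 3 "1 - x"] by simp
    then have "x * (1 - x)^3 \<le> x * (1 - x)"
      using that by (intro mult_left_mono) auto
    also have "\<dots> \<le> 1 / 4"
      using zero_le_power2[of "2 * x - 1"] by (simp add: power2_eq_square algebra_simps)
    finally show ?thesis
      using that by (simp add: q_def)
  qed
  have bound: "\<bar>c - (\<Sum>n<N. a n)\<bar> \<le> 6 * (1 / 2) ^ N" for N
  proof -
    have eq: "6 * (- ln x / (1 + 3 * x^2)) - (\<Sum>n<N. t n x) = 6 * (- ln x / (1 + 3 * x^2)) * q x ^ N"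
      for x :: real
    proof -
      have pos: "1 + 3 * x^2 > 0"
        by (intro add_pos_nonneg) auto
      \<comment> \<open>This factorization cancels the quadratic weight of the terms against
        \<open>1 - q x\<close>, leaving only \<open>1 + 3 * x^2\<close> in the denominator.\<close>
      have "(1 + 3 * x^2) * (3 * (1-x)^2 + 3 * (1-x) + 2) = 8 * (1 - q x)"
        by (simp add: q_def algebra_simps power2_eq_square power3_eq_cube)
      then have "(1 + 3 * x^2) * (3 * (1-x)^2 + 3 * (1-x) + 2) * (\<Sum>n<N. q x ^ n) = 8 * (1 - q x ^ N)"
        using one_diff_power_eq[of "q x" N] by simp
      then have "(3 * (1-x)^2 + 3 * (1-x) + 2) * (\<Sum>n<N. q x ^ n) = 8 * (1 - q x ^ N) / (1 + 3 * x^2)"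
        using pos by (simp add: field_simps)
      moreover have "(\<Sum>n<N. t n x)
          = 3 / 4 * - ln x * ((3 * (1-x)^2 + 3 * (1-x) + 2) * (\<Sum>n<N. q x ^ n))"
        unfolding t_def sum_distrib_left by (simp only: mult.assoc)
      moreover have "6 * (l / w) - 3 / 4 * l * (8 * (1 - Q) / w) = 6 * (l / w) * Q" for l w Q :: real
        by (simp add: diff_divide_distrib right_diff_distrib)
      ultimately show ?thesis
        by (simp only:)
    qed
    have int: "((\<lambda>x. 6 * (- ln x / (1 + 3 * x^2)) * q x ^ N) has_integral c - (\<Sum>n<N. a n)) {0..1}"
      unfolding eq[symmetric] by (intro has_integral_diff int6 has_integral_sum trm) auto
    have nn: "- ln x \<ge> 0" if "x \<in> {0..1}" for x :: real
      using that by (cases "x = 0") auto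
    have "c - (\<Sum>n<N. a n) \<ge> 0"
    proof (rule has_integral_nonneg[OF int])
      fix x :: real
      assume x: "x \<in> {0..1}"
      show "0 \<le> 6 * (- ln x / (1 + 3 * x^2)) * q x ^ N"
        by (intro mult_nonneg_nonneg divide_nonneg_nonneg zero_le_power nn x) (use q[OF x] in auto)
    qed
    moreover have "c - (\<Sum>n<N. a n) \<le> 6 * (1 / 2) ^ N"
    proof (rule has_integral_le[OF int])
      \<comment> \<open>The integral of \<open>- ln x\<close> over the unit interval is 1, the
        moment for \<open>m = 0\<close>.\<close>
      show "((\<lambda>x::real. 6 * (1 / 2) ^ N * (- ln x)) has_integral 6 * (1 / 2) ^ N) {0..1}"
        using has_integral_mult_right[OF has_integral_power_ln[of 0], of "6 * (1 / 2) ^ N"] by simp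
      fix x :: real
      assume x: "x \<in> {0..1}"
      have "1 + 3 * x^2 \<ge> 1" "1 + 3 * x^2 > 0"
        by (auto intro: add_pos_nonneg)
      then have "- ln x / (1 + 3 * x^2) \<le> - ln x"
        using divide_left_mono[of 1 "1 + 3 * x^2" "- ln x"] nn[OF x] by simp
      then have "- ln x / (1 + 3 * x^2) * q x ^ N \<le> - ln x * (1 / 2) ^ N"
        using q[OF x] nn[OF x] by (intro mult_mono power_mono) auto
      then have "6 * (- ln x / (1 + 3 * x^2) * q x ^ N) \<le> 6 * (- ln x * (1 / 2) ^ N)"
        by (rule mult_left_mono) simp
      then show "6 * (- ln x / (1 + 3 * x^2)) * q x ^ N \<le> 6 * (1 / 2) ^ N * (- ln x)"
        by (simp only: mult_ac)
    qed
    ultimately show ?thesis by simp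
  qed
  have "a sums c"
    unfolding sums_def
  proof (rule LIM_zero_cancel, rule Lim_null_comparison)
    show "eventually (\<lambda>N. norm ((\<Sum>n<N. a n) - c) \<le> 6 * (1 / 2) ^ N) sequentially"
      using bound by (simp add: abs_minus_commute)
    show "(\<lambda>N. 6 * (1 / 2 :: real) ^ N) \<longlonglongrightarrow> 0"
      by (intro tendsto_mult_right_zero LIMSEQ_power_zero) auto
  qed
  \<comment> \<open>The log-sine part of \<open>c\<close> is
    \<open>- 15 / sqrt 3 * log_sine (pi / 3)\<close>, which is 15/4 times
    \<open>K_const\<close>.\<close>
  also have "c = pi * sqrt 3 / 3 * ln 3 + 15 / 4 * K_const"
    unfolding c_def K_const_log_sine by (simp add: field_simps)
  finally show ?thesis
    unfolding a_def .
qed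

end
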